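(* Let $<G(V,E,P),C,B>$ be an instance of the Budgeted Influence Maximization Problem with $n$ nodes, $m$ edges and maximum degree $d_{max}$. Consider the methodology that first computes approximate Shapley values by Algorithm A (with $\tau$ permutations and $\mathcal{R}$ repetitions) and then uses Algorithm M1 for seed set selection, both algorithms being as given in the context. Its running time is $\mathcal{O}(\tau\cdot n\cdot(m+n)\cdot\mathcal{R}+n\log n+n\,d_{max})$ and its space requirement is $\mathcal{O}(n)$.
   Context: Instance: a social network $G(V,E,P)$ with node set $V(G)$, edge set $E(G)$ and influence probabilities $P:E(G)\to(0,1]$; a cost function $C:V(G)\to\mathbb{Z}^+$; a budget $B$. One seeks a seed set $S\subseteq V(G)$ with $C(S)=\sum_{u\in S}C(u)\le B$ maximizing the influence. $N(u)$ is the set of neighbours of $u$ and $\deg(u)$ its degree. For $S\subseteq V(G)$, $\nu(S)=\sigma(S)=\sum_{v\in V(G)}ap(v,S,MIIA(v,\theta))$ is the expected influence of $S$ in the Maximum Influence Arborescence (MIA) diffusion model. Here the propagation probability of a path is the product of the probabilities of its edges; $MIIA(v,\theta)$ is the union, over all $u\neq v$, of those maximum-probability paths from $u$ to $v$ whose propagation probability is at least a cut-off $\theta$; and $ap(v,S,MIIA(v,\theta))$ is the probability that $v$ is influenced by $S$ when influence travels to $v$ only through $MIIA(v,\theta)$. Algorithm A (approximate Shapley values). Input: the instance, error $\epsilon$, probability $\delta$, range of marginal contribution $r$, and the number of repetitions $\mathcal{R}$. 1. For each $u\in V(G)$: $b_u\leftarrow 0$; $c_u\leftarrow\frac{\deg(u)}{2}+\sum_{w\in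 N(u)}\frac{1}{\deg(w)-1}$. 2. $r=\frac1n\sum_{u\in V(G)}c_u$. 3. Generate $\tau\ge\lceil\ln(2/\delta)\,r^2/(2\epsilon^2)\rceil$ permutations $p_1,\dots,p_\tau$ of the nodes. 4. Create arrays $\phi$ and $MG$ of size $n$, initialized with $0$. 5. For $i=1$ to $\tau$: { for each $u\in V(G)$ set $T(u)=0$; for $j=1$ to $\mathcal{R}$: { for each $u\in V(G)$: $T(u)=T(u)+\nu(S_u(p_i)\cup\{u\})-\nu(S_u(p_i))$, where $S_u(p_i)$ is the set of nodes appearing before $u$ in $p_i$; then $MG(u)=T(u)/\mathcal{R}$ } }. 6. For each $u\in V(G)$: $\phi(u)=MG(u)/\tau$. Return $\phi$. Algorithm M1 (Method 1). Input: the instance and $\phi$. 1. Sort the nodes based on the Shapley values in $\phi$, giving $u_1,\dots,u_n$. 2. $S=\emptyset$; create an array $Flag$ of size $n$ with every entry $1$. 3. For $i=1$ to $n$: { while $B>0$: { if $B\ge C(u_i)$ and $Flag(u_i)=1$, then $S\leftarrow S\cup\{u_i\}$ and $B\leftarrow B-C(u_i)$; for all $v\in N(u_i)$: $Flag(v)\leftarrow 0$ } }. 4. Return $S$. Cost assumptions: all degrees are computed in $\mathcal{O}(n^2)$ time; the marginal contribution of a node is computed by traversing the graph in $\mathcal{O}(m+n)$ time; space means the extra space consumed.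
   Formalization: In M1, "while B>0" is a test made once per node (literally the loop may never end); the permutations are generated one at a time (storing all takes τn cells); the degree and marginal-contribution computations are assumed to use O(n) working space. *)

theory Defs
  imports
    "HOL-Probability.Product_PMF"
    "HOL-Library.Landau_Symbols"
    "Graph_Theory.Arc_Walk"
begin

section \<open>Budgeted influence maximization in the MIA model\<close>

text \<open>
  A network is a finite digraph without loops and parallel arcs.  An undirected network is given
  by two opposite arcs per edge.
\<close>

record ('a, 'b) bim =
  net :: "('a, 'b) pre_digraph"
  prob :: "'b \<Rightarrow> real"
  cost :: "'a \<Rightarrow> int"
  budget :: int
  cutoff :: real

definition bim_instance :: "('a, 'b) bim \<Rightarrow> bool" where
  "bim_instance I \<longleftrightarrow>
     digraph (net I) \<and> verts (net I) \<noteq> {} \<and>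
     (\<forall>e\<in>arcs (net I). 0 < prob I e \<and> prob I e \<le> 1) \<and>
     (\<forall>u\<in>verts (net I). 0 < cost I u)"

definition num_nodes :: "('a, 'b) bim \<Rightarrow> nat" where
  "num_nodes I = card (verts (net I))"

definition num_edges :: "('a, 'b) bim \<Rightarrow> nat" where
  "num_edges I = card (arcs (net I))"

definition nbrs :: "('a, 'b) bim \<Rightarrow> 'a \<Rightarrow> 'a set" where
  "nbrs I u = {v \<in> verts (net I). (u, v) \<in> arcs_ends (net I) \<or> (v, u) \<in> arcs_ends (net I)}"

definition deg :: "('a, 'b) bim \<Rightarrow> 'a \<Rightarrow> nat" where
  "deg I u = card (nbrs I u)"

definition max_deg :: "('a, 'b) bim \<Rightarrow> nat" where
  "max_deg I = Max (deg I ` verts (net I))"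

definition path_prob :: "('a, 'b) bim \<Rightarrow> 'b list \<Rightarrow> real" where
  "path_prob I p = prod_list (map (prob I) p)"

definition max_prob_path :: "('a, 'b) bim \<Rightarrow> 'a \<Rightarrow> 'b list \<Rightarrow> 'a \<Rightarrow> bool" where
  "max_prob_path I u p v \<longleftrightarrow>
     pre_digraph.apath (net I) u p v \<and>
     (\<forall>q. pre_digraph.apath (net I) u q v \<longrightarrow> path_prob I q \<le> path_prob I p)"

text \<open>No tie-breaking: if several paths from a node attain the maximum, all of them are included.\<close>

definition miia :: "('a, 'b) bim \<Rightarrow> 'a \<Rightarrow> 'b set" where
  "miia I v = \<Union> {set p | p. \<exists>u\<in>verts (net I).
                 u \<noteq> v \<and> max_prob_path I u p v \<and> cutoff I \<le> path_prob I p}"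

text \<open>
  Every arc of \<open>A\<close> transmits independently with its influence probability; \<open>v\<close> is influenced if
  it is reachable from a seed through transmitting arcs.
\<close>

definition ap :: "('a, 'b) bim \<Rightarrow> 'a \<Rightarrow> 'a set \<Rightarrow> 'b set \<Rightarrow> real" where
  "ap I v S A = measure_pmf.prob (Pi_pmf A False (\<lambda>e. bernoulli_pmf (prob I e)))
     {X. \<exists>s\<in>S. s \<rightarrow>\<^sup>*\<^bsub>(net I)\<lparr>arcs := {e \<in> A. X e}\<rparr>\<^esub> v}"

definition influence :: "('a, 'b) bim \<Rightarrow> 'a set \<Rightarrow> real" where
  "influence I S = (\<Sum>v\<in>verts (net I). ap I v S (miia I v))"


section \<open>Programs with time and space\<close>

text \<open>
  The store holds what the algorithms keep in addition to their read-only input.  Arrays over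
  nodes are partial maps whose domain consists of the cells written so far.
\<close>

record 'a store =
  degs :: "'a \<rightharpoonup> nat"
  b_arr :: "'a \<rightharpoonup> real"
  c_arr :: "'a \<rightharpoonup> real"
  range_r :: real
  perm :: "'a list"
  before :: "'a set"
  T_arr :: "'a \<rightharpoonup> real"
  MG :: "'a \<rightharpoonup> real"
  phi :: "'a \<rightharpoonup> real"
  ranked :: "'a list"
  flag :: "'a \<rightharpoonup> nat"
  seeds :: "'a set"
  money :: int

definition cells :: "'a store \<Rightarrow> nat" where
  "cells s =
     card (dom (degs s)) + card (dom (b_arr s)) + card (dom (c_arr s)) + length (perm s) +
     card (before s) + card (dom (T_arr s)) + card (dom (MG s)) + card (dom (phi s)) +
     length (ranked s) + card (dom (flag s)) + card (seeds s) + 2"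

text \<open>
  A command maps a store to the final store, the time spent, and the largest number of cells
  occupied on the way.
\<close>

type_synonym 'a cmd = "'a store \<Rightarrow> 'a store \<times> nat \<times> nat"

definition call ::
  "('a store \<Rightarrow> nat) \<Rightarrow> ('a store \<Rightarrow> nat) \<Rightarrow> ('a store \<Rightarrow> 'a store) \<Rightarrow> 'a cmd" where
  "call time work f s = (f s, time s, max (cells s + work s) (cells (f s)))"

text \<open>
  One elementary assignment.  Below it only writes boundedly many cells, computed from boundedly
  many operands, or resets a list or a set to the empty one.
\<close>

definition step :: "('a store \<Rightarrow> 'a store) \<Rightarrow> 'a cmd" where
  "step f = call (\<lambda>_. 1) (\<lambda>_. 0) f"

definition skip :: "'a cmd" where
  "skip s = (s, 0, cells s)"

definition andthen :: "'a cmd \<Rightarrow> 'a cmd \<Rightarrow> 'a cmd" (infixr "\<triangleright>" 60) where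
  "(c \<triangleright> d) s =
     (let (s1, t1, p1) = c s; (s2, t2, p2) = d s1 in (s2, t1 + t2, max p1 p2))"

definition cond :: "('a store \<Rightarrow> bool) \<Rightarrow> 'a cmd \<Rightarrow> 'a cmd \<Rightarrow> 'a cmd" where
  "cond b c d s = (let (s1, t1, p1) = (if b s then c s else d s) in (s1, t1 + 1, p1))"

primrec iterate :: "'x list \<Rightarrow> ('x \<Rightarrow> 'a cmd) \<Rightarrow> 'a cmd" where
  "iterate [] c = skip"
| "iterate (x # xs) c = step (\<lambda>s. s) \<triangleright> c x \<triangleright> iterate xs c"

text \<open>One time unit per iteration and one on exit; one cell for the loop variable.\<close>

definition foreach :: "('a store \<Rightarrow> 'x list) \<Rightarrow> ('x \<Rightarrow> 'a cmd) \<Rightarrow> 'a cmd" where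
  "foreach xs c s = (let (s1, t1, p1) = iterate (xs s) c s in (s1, t1 + 1, p1 + 1))"


section \<open>Sorting\<close>

text \<open>Merge sort by non-increasing key.\<close>

fun merge :: "('a \<Rightarrow> real) \<Rightarrow> 'a list \<Rightarrow> 'a list \<Rightarrow> 'a list" where
  "merge f [] ys = ys"
| "merge f xs [] = xs"
| "merge f (x # xs) (y # ys) =
     (if f y \<le> f x then x # merge f xs (y # ys) else y # merge f (x # xs) ys)"

fun t_merge :: "('a \<Rightarrow> real) \<Rightarrow> 'a list \<Rightarrow> 'a list \<Rightarrow> nat" where
  "t_merge f [] ys = length ys + 1"
| "t_merge f xs [] = length xs + 1"
| "t_merge f (x # xs) (y # ys) =
     1 + (if f y \<le> f x then t_merge f xs (y # ys) else t_merge f (x # xs) ys)"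

function msort :: "('a \<Rightarrow> real) \<Rightarrow> 'a list \<Rightarrow> 'a list" where
  "msort f xs =
     (let h = length xs div 2 in
      if h = 0 then xs else merge f (msort f (take h xs)) (msort f (drop h xs)))"
  by pat_completeness auto
termination by (relation "Wellfounded.measure (\<lambda>(f, xs). length xs)") auto

declare msort.simps [simp del]

text \<open>The summand \<open>length xs\<close> is the cost of copying the two halves.\<close>

function t_msort :: "('a \<Rightarrow> real) \<Rightarrow> 'a list \<Rightarrow> nat" where
  "t_msort f xs =
     (let h = length xs div 2 in
      if h = 0 then 1
      else 1 + length xs + t_msort f (take h xs) + t_msort f (drop h xs) +
           t_merge f (msort f (take h xs)) (msort f (drop h xs)))"
  by pat_completeness auto
termination by (relation "Wellfounded.measure (\<lambda>(f, xs). length xs)") auto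

declare t_msort.simps [simp del]

text \<open>
  Each call uses a cell for its stack frame, \<open>length xs\<close> cells for the two halves and
  \<open>length xs\<close> cells for the merged list; the two recursive calls reuse the same space.
\<close>

function w_msort :: "'a list \<Rightarrow> nat" where
  "w_msort xs =
     (let h = length xs div 2 in
      if h = 0 then 1
      else 1 + 2 * length xs + max (w_msort (take h xs)) (w_msort (drop h xs)))"
  by pat_completeness auto
termination by (relation "Wellfounded.measure length") auto

declare w_msort.simps [simp del]


section \<open>The algorithms\<close>

text \<open>
  \<open>nodes\<close> and \<open>adj\<close> are the adjacency-list representation of the network.  \<open>draw i k\<close> is the
  random number used for position \<open>k\<close> when the \<open>i\<close>-th permutation is generated.
\<close>

record 'a params =
  nodes :: "'a list"
  adj :: "'a \<Rightarrow> 'a list"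
  epsilon :: real
  delta :: real
  tau :: nat
  reps :: nat
  draw :: "nat \<Rightarrow> nat \<Rightarrow> nat"

text \<open>The summand for \<open>deg I w = 1\<close> is \<open>1 / 0 = 0\<close>.\<close>

definition c_value :: "('a, 'b) bim \<Rightarrow> 'a \<Rightarrow> real" where
  "c_value I u = real (deg I u) / 2 + (\<Sum>w\<in>nbrs I u. 1 / (real (deg I w) - 1))"

definition range_value :: "('a, 'b) bim \<Rightarrow> real" where
  "range_value I = 1 / real (num_nodes I) * (\<Sum>u\<in>verts (net I). c_value I u)"

definition valid_params :: "('a, 'b) bim \<Rightarrow> 'a params \<Rightarrow> bool" where
  "valid_params I A \<longleftrightarrow>
     distinct (nodes A) \<and> set (nodes A) = verts (net I) \<and>
     (\<forall>u\<in>verts (net I). distinct (adj A u) \<and> set (adj A u) = nbrs I u) \<and>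
     0 < epsilon A \<and> 0 < delta A \<and> delta A < 1 \<and> 1 \<le> reps A \<and> 1 \<le> tau A \<and>
     \<lceil>ln (2 / delta A) * (range_value I)\<^sup>2 / (2 * (epsilon A)\<^sup>2)\<rceil> \<le> int (tau A)"

text \<open>
  Time and working space of the two subroutines, on which the analysis makes assumptions instead
  of fixing an implementation: computing all degrees, and computing the marginal contribution of a
  node to a set of nodes.
\<close>

record ('a, 'b) subroutines =
  deg_time :: "('a, 'b) bim \<Rightarrow> nat"
  deg_work :: "('a, 'b) bim \<Rightarrow> nat"
  mc_time :: "('a, 'b) bim \<Rightarrow> 'a set \<Rightarrow> 'a \<Rightarrow> nat"
  mc_work :: "('a, 'b) bim \<Rightarrow> 'a set \<Rightarrow> 'a \<Rightarrow> nat"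

definition compute_degrees :: "('a, 'b) subroutines \<Rightarrow> ('a, 'b) bim \<Rightarrow> 'a cmd" where
  "compute_degrees Q I =
     call (\<lambda>_. deg_time Q I) (\<lambda>_. deg_work Q I)
       (degs_update (\<lambda>_ u. if u \<in> verts (net I) then Some (deg I u) else None))"

definition compute_range :: "('a, 'b) bim \<Rightarrow> 'a params \<Rightarrow> 'a cmd" where
  "compute_range I A =
     foreach (\<lambda>_. nodes A) (\<lambda>u.
       step (\<lambda>s. s\<lparr>b_arr := (b_arr s)(u \<mapsto> 0)\<rparr>) \<triangleright>
       step (\<lambda>s. s\<lparr>c_arr := (c_arr s)(u \<mapsto> real (the (degs s u)) / 2)\<rparr>) \<triangleright>
       foreach (\<lambda>_. adj A u) (\<lambda>w.
         step (\<lambda>s. s\<lparr>c_arr :=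
           (c_arr s)(u \<mapsto> the (c_arr s u) + 1 / (real (the (degs s w)) - 1))\<rparr>))) \<triangleright>
     step (\<lambda>s. s\<lparr>range_r := 0\<rparr>) \<triangleright>
     foreach (\<lambda>_. nodes A) (\<lambda>u. step (\<lambda>s. s\<lparr>range_r := range_r s + the (c_arr s u)\<rparr>)) \<triangleright>
     step (\<lambda>s. s\<lparr>range_r := 1 / real (num_nodes I) * range_r s\<rparr>)"

text \<open>
  Fisher--Yates shuffle.  Only the current permutation is stored: the next one overwrites it.
\<close>

definition generate_perm :: "'a params \<Rightarrow> nat \<Rightarrow> 'a cmd" where
  "generate_perm A i =
     step (\<lambda>s. s\<lparr>perm := []\<rparr>) \<triangleright>
     foreach (\<lambda>_. nodes A) (\<lambda>u. step (\<lambda>s. s\<lparr>perm := perm s @ [u]\<rparr>)) \<triangleright>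
     foreach (\<lambda>_. rev [1..<length (nodes A)]) (\<lambda>k.
       step (\<lambda>s. let j = draw A i k mod Suc k in
         s\<lparr>perm := (perm s)[j := perm s ! k, k := perm s ! j]\<rparr>))"

text \<open>
  The first loop scans the permutation up to \<open>u\<close> to collect \<open>before\<close>, the set of its predecessors.
\<close>

definition add_marginal ::
  "('a, 'b) subroutines \<Rightarrow> ('a, 'b) bim \<Rightarrow> 'a \<Rightarrow> 'a cmd" where
  "add_marginal Q I u =
     step (\<lambda>s. s\<lparr>before := {}\<rparr>) \<triangleright>
     foreach (\<lambda>s. takeWhile (\<lambda>w. w \<noteq> u) (perm s)) (\<lambda>w.
       step (\<lambda>s. s\<lparr>before := insert w (before s)\<rparr>)) \<triangleright>
     call (\<lambda>s. mc_time Q I (before s) u) (\<lambda>s. mc_work Q I (before s) u)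
       (\<lambda>s. s\<lparr>T_arr := (T_arr s)(u \<mapsto>
          the (T_arr s u) + influence I (before s \<union> {u}) - influence I (before s))\<rparr>)"

definition approx_shapley ::
  "('a, 'b) subroutines \<Rightarrow> ('a, 'b) bim \<Rightarrow> 'a params \<Rightarrow> 'a cmd" where
  "approx_shapley Q I A =
     compute_degrees Q I \<triangleright>
     compute_range I A \<triangleright>
     foreach (\<lambda>_. nodes A) (\<lambda>u.
       step (\<lambda>s. s\<lparr>phi := (phi s)(u \<mapsto> 0)\<rparr>) \<triangleright>
       step (\<lambda>s. s\<lparr>MG := (MG s)(u \<mapsto> 0)\<rparr>)) \<triangleright>
     foreach (\<lambda>_. [1..<Suc (tau A)]) (\<lambda>i.
       generate_perm A i \<triangleright>
       foreach (\<lambda>_. nodes A) (\<lambda>u. step (\<lambda>s. s\<lparr>T_arr := (T_arr s)(u \<mapsto> 0)\<rparr>)) \<triangleright>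
       foreach (\<lambda>_. [1..<Suc (reps A)]) (\<lambda>j.
         foreach (\<lambda>_. nodes A) (\<lambda>u.
           add_marginal Q I u \<triangleright>
           step (\<lambda>s. s\<lparr>MG := (MG s)(u \<mapsto> the (T_arr s u) / real (reps A))\<rparr>)))) \<triangleright>
     foreach (\<lambda>_. nodes A) (\<lambda>u.
       step (\<lambda>s. s\<lparr>phi := (phi s)(u \<mapsto> the (MG s u) / real (tau A))\<rparr>))"

definition sort_nodes :: "'a params \<Rightarrow> 'a cmd" where
  "sort_nodes A =
     call (\<lambda>s. t_msort (\<lambda>u. the (phi s u)) (nodes A)) (\<lambda>_. w_msort (nodes A))
       (\<lambda>s. s\<lparr>ranked := msort (\<lambda>u. the (phi s u)) (nodes A)\<rparr>)"

text \<open>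
  The source nests a loop ``while B > 0'' in the loop over the nodes.  It is read as the
  condition for going on with the outer loop: as an inner loop on a fixed node it would not
  terminate once the node has become unaffordable while some budget is left.
  A selected node is new in \<open>seeds\<close>, since the nodes are visited once each.
\<close>

definition select_seeds :: "('a, 'b) bim \<Rightarrow> 'a params \<Rightarrow> 'a cmd" where
  "select_seeds I A =
     sort_nodes A \<triangleright>
     step (\<lambda>s. s\<lparr>seeds := {}\<rparr>) \<triangleright>
     foreach (\<lambda>_. nodes A) (\<lambda>u. step (\<lambda>s. s\<lparr>flag := (flag s)(u \<mapsto> 1)\<rparr>)) \<triangleright>
     foreach ranked (\<lambda>u.
       cond (\<lambda>s. money s > 0)
         (cond (\<lambda>s. money s \<ge> cost I u \<and> the (flag s u) = 1)
            (step (\<lambda>s. s\<lparr>seeds := seeds s \<union> {u}\<rparr>) \<triangleright>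
             step (\<lambda>s. s\<lparr>money := money s - cost I u\<rparr>))
            skip \<triangleright>
          foreach (\<lambda>_. adj A u) (\<lambda>v. step (\<lambda>s. s\<lparr>flag := (flag s)(v \<mapsto> 0)\<rparr>)))
         skip)"

definition initial_store :: "('a, 'b) bim \<Rightarrow> 'a store" where
  "initial_store I =
     \<lparr>degs = Map.empty, b_arr = Map.empty, c_arr = Map.empty, range_r = 0, perm = [],
      before = {}, T_arr = Map.empty, MG = Map.empty, phi = Map.empty, ranked = [],
      flag = Map.empty, seeds = {}, money = budget I\<rparr>"

definition methodology ::
  "('a, 'b) subroutines \<Rightarrow> ('a, 'b) bim \<Rightarrow> 'a params \<Rightarrow> 'a store \<times> nat \<times> nat" where
  "methodology Q I A = (approx_shapley Q I A \<triangleright> select_seeds I A) (initial_store I)"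

definition running_time ::
  "('a, 'b) subroutines \<Rightarrow> ('a, 'b) bim \<Rightarrow> 'a params \<Rightarrow> nat" where
  "running_time Q I A = fst (snd (methodology Q I A))"

definition extra_space ::
  "('a, 'b) subroutines \<Rightarrow> ('a, 'b) bim \<Rightarrow> 'a params \<Rightarrow> nat" where
  "extra_space Q I A = snd (snd (methodology Q I A))"

text \<open>
  Sets of inputs.  With the filter \<^term>\<open>principal X\<close>, membership in the Landau class \<open>O\<close> is a
  bound with one constant for all inputs in \<open>X\<close>.
\<close>

definition instances :: "('a, 'b) bim set" where
  "instances = {I. bim_instance I}"

definition mc_inputs :: "(('a, 'b) bim \<times> 'a set \<times> 'a) set" where
  "mc_inputs = {(I, S, u). bim_instance I \<and> S \<subseteq> verts (net I) \<and> u \<in> verts (net I)}"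

definition run_inputs :: "(('a, 'b) bim \<times> 'a params) set" where
  "run_inputs = {(I, A). bim_instance I \<and> valid_params I A}"

end

theory Submission
  imports Defs
begin

text \<open>
  Every array has at most one cell per node and every list at most \<open>n\<close> entries, and this
  invariant bounds the occupied cells by \<open>11 n + 2\<close>; the subroutines and merge sort add
  linear working space.  For the time, the innermost loop dominates: with \<open>W = m + n\<close> one
  marginal contribution costs \<open>O(W)\<close>, hence the permutation loop \<open>O(\<tau> n W R)\<close>.  All
  remaining phases take time \<open>O(n\<^sup>2)\<close>, which the same term absorbs because
  \<open>\<tau>, R \<ge> 1\<close> and \<open>n \<le> W\<close>; so a quadratic bound for merge sort suffices.
\<close>

section \<open>Resource triples\<close>

text \<open>A total-correctness Hoare triple carrying resource bounds. Under sequencing, times add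
  up, whereas \<open>p\<close> is a peak and is therefore kept as one common bound for all parts of
  a program.\<close>

definition runs ::
  "('a store \<Rightarrow> bool) \<Rightarrow> 'a cmd \<Rightarrow> ('a store \<Rightarrow> bool) \<Rightarrow> nat \<Rightarrow> nat \<Rightarrow> bool" where
  "runs P c R t p \<longleftrightarrow>
     (\<forall>s. P s \<longrightarrow> R (fst (c s)) \<and> fst (snd (c s)) \<le> t \<and> snd (snd (c s)) \<le> p)"

lemma runs_weaken:
  assumes "runs P c R t p" "t \<le> t'" "p \<le> p'"
  shows "runs P c R t' p'"
  using assms unfolding runs_def by fastforce

lemma runs_consequence:
  assumes "runs P c R t p" "\<And>s. P' s \<Longrightarrow> P s" "\<And>s. R s \<Longrightarrow> R' s"
  shows "runs P' c R' t p"
  using assms unfolding runs_def by fastforce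

lemma runs_call:
  assumes "\<And>s. P s \<Longrightarrow>
    R (f s) \<and> time s \<le> t \<and> cells s + work s \<le> p \<and> cells (f s) \<le> p"
  shows "runs P (call time work f) R t p"
  using assms by (auto simp: runs_def call_def)

lemma runs_step:
  assumes "\<And>s. P s \<Longrightarrow> R (f s)"
    and "\<And>s. P s \<Longrightarrow> cells s \<le> p" "\<And>s. R s \<Longrightarrow> cells s \<le> p"
  shows "runs P (step f) R 1 p"
  unfolding step_def by (rule runs_call) (simp add: assms)

lemma runs_skip:
  assumes "\<And>s. P s \<Longrightarrow> cells s \<le> p"
  shows "runs P skip P 0 p"
  using assms by (auto simp: runs_def skip_def)

lemma runs_andthen:
  assumes "runs P c R t p" "runs R d S t' p"
  shows "runs P (c \<triangleright> d) S (t + t') p"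
  using assms unfolding runs_def andthen_def by (simp add: Let_def case_prod_beta add_mono)

lemma runs_cond:
  assumes "runs P c R t p" "runs P d R t' p"
  shows "runs P (cond b c d) R (Suc (max t t')) p"
  using assms by (simp add: runs_def cond_def Let_def case_prod_beta max.coboundedI1 max.coboundedI2)

text \<open>The invariant \<open>J\<close> is indexed by the iteration count because the loop that
  builds the permutation lengthens it at each pass. The start index \<open>i\<close> is arbitrary so
  that the induction can move past the first element; \<open>Suc t\<close> includes the
  \<open>step\<close> that \<open>iterate\<close> puts before each body.\<close>

lemma runs_iterate_indexed:
  assumes "\<And>k x. i \<le> k \<Longrightarrow> k < i + length xs \<Longrightarrow> x \<in> set xs \<Longrightarrow> runs (J k) (c x) (J (Suc k)) t p"
    and "\<And>k s. k \<le> i + length xs \<Longrightarrow> J k s \<Longrightarrow> cells s \<le> p"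
  shows "runs (J i) (iterate xs c) (J (i + length xs)) (length xs * Suc t) p"
  using assms
proof (induction xs arbitrary: i)
  case Nil
  have "runs (J i) skip (J i) 0 p"
    by (rule runs_skip, rule Nil.prems(2)[of i]) simp_all
  then show ?case by simp
next
  case (Cons x xs)
  have "runs (J i) (step (\<lambda>s. s)) (J i) 1 p"
    using Cons.prems(2)[of i] by (intro runs_step) simp_all
  moreover have "runs (J i) (c x) (J (Suc i)) t p"
    using Cons.prems(1) by simp
  moreover have "runs (J (Suc i)) (iterate xs c) (J (Suc i + length xs)) (length xs * Suc t) p"
    by (rule Cons.IH) (use Cons.prems in auto)
  ultimately have "runs (J i) (step (\<lambda>s. s) \<triangleright> c x \<triangleright> iterate xs c) (J (Suc i + length xs))
      (1 + (t + length xs * Suc t)) p"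
    by (blast intro: runs_andthen)
  then show ?case by (simp add: algebra_simps)
qed

lemma runs_foreach_indexed:
  assumes "\<And>k x. k < length xs \<Longrightarrow> x \<in> set xs \<Longrightarrow> runs (J k) (c x) (J (Suc k)) t p"
    and "\<And>k s. k \<le> length xs \<Longrightarrow> J k s \<Longrightarrow> cells s \<le> p"
  shows "runs (J 0) (foreach (\<lambda>_. xs) c) (J (length xs)) (Suc (length xs * Suc t)) (Suc p)"
  using runs_iterate_indexed[of 0 xs J c t p] assms
  by (simp add: runs_def foreach_def case_prod_beta)

text \<open>\<open>foreach\<close> evaluates its list once, in the store at loop entry. For a fixed
  entry store the list is thus constant and the indexed rule applies with a constant
  \<open>J\<close>; \<open>N\<close> then covers all entry stores.\<close>

lemma runs_foreach:
  assumes "\<And>s. P s \<Longrightarrow> length (xs s) \<le> N \<and> set (xs s) \<subseteq> X"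
    and "\<And>x. x \<in> X \<Longrightarrow> runs P (c x) P t p"
    and "\<And>s. P s \<Longrightarrow> cells s \<le> p"
  shows "runs P (foreach xs c) P (Suc (N * Suc t)) (Suc p)"
proof -
  have "P (fst (foreach xs c s)) \<and> fst (snd (foreach xs c s)) \<le> Suc (N * Suc t)
      \<and> snd (snd (foreach xs c s)) \<le> Suc p"
    if "P s" for s
  proof -
    have "runs P (foreach (\<lambda>_. xs s) c) P (Suc (length (xs s) * Suc t)) (Suc p)"
      by (rule runs_foreach_indexed[where J = "\<lambda>_. P"]) (use assms that in auto)
    then have "runs P (foreach (\<lambda>_. xs s) c) P (Suc (N * Suc t)) (Suc p)"
      by (rule runs_weaken) (use assms(1)[OF that] in \<open>simp_all add: add_mono\<close>)
    then show ?thesis using that by (auto simp: runs_def foreach_def)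
  qed
  then show ?thesis by (simp add: runs_def)
qed

section \<open>Merge sort\<close>

lemma length_merge [simp]: "length (merge f xs ys) = length xs + length ys"
  by (induction f xs ys rule: merge.induct) auto

lemma set_merge [simp]: "set (merge f xs ys) = set xs \<union> set ys"
  by (induction f xs ys rule: merge.induct) auto

lemma length_msort [simp]: "length (msort f xs) = length xs"
proof (induction f xs rule: msort.induct)
  case (1 f xs)
  show ?case
    by (subst msort.simps) (use 1 in \<open>auto simp: Let_def\<close>)
qed

lemma set_msort [simp]: "set (msort f xs) = set xs"
proof (induction f xs rule: msort.induct)
  case (1 f xs)
  have "set (take h xs) \<union> set (drop h xs) = set xs" for h
    by (metis append_take_drop_id set_append)
  then show ?case
    by (subst msort.simps) (use 1 in \<open>simp add: Let_def\<close>)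
qed

lemma t_merge_le: "t_merge f xs ys \<le> length xs + length ys + 1"
  by (induction f xs ys rule: t_merge.induct) auto

text \<open>With halves of lengths \<open>h\<close> and \<open>k\<close> the recursion costs at most
  4h^2 + 4k^2 + 2(h + k) + 4, so the cross term 8hk of 4(h + k)^2 has to absorb 2(h + k) +
  3.\<close>

lemma t_msort_le: "t_msort f xs \<le> 4 * (length xs)\<^sup>2 + 1"
proof (induction f xs rule: t_msort.induct)
  case (1 f xs)
  define h where "h = length xs div 2"
  show ?case
  proof (cases "h = 0")
    case True
    then show ?thesis by (subst t_msort.simps) (simp add: h_def Let_def)
  next
    case False
    define k where "k = length xs - h"
    have len: "length xs = h + k" and hk: "1 \<le> h" "h \<le> k"
      using False by (auto simp: h_def k_def)
    \<comment> \<open>Both \<open>h\<close> and \<open>k\<close> are at most \<open>h * k\<close>.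
      Together with 1 \<le> hk this yields 2(h + k) + 3 \<le> 7hk.\<close>
    have "h + k \<le> 2 * (h * k)" using hk
      by (metis One_nat_def add_mono le_trans mult.commute mult_2 mult_le_mono1 mult_le_mono2
          nat_mult_1)
    moreover have "1 * 1 \<le> h * k" using hk by (intro mult_le_mono) auto
    moreover have "t_msort f (take h xs) \<le> 4 * h\<^sup>2 + 1" "t_msort f (drop h xs) \<le> 4 * k\<^sup>2 + 1"
      using 1[OF h_def False] by (simp_all add: len)
    moreover have "t_merge f (msort f (take h xs)) (msort f (drop h xs)) \<le> h + k + 1"
      using t_merge_le[of f "msort f (take h xs)" "msort f (drop h xs)"] len by simp
    moreover have "t_msort f xs = 1 + length xs + t_msort f (take h xs) + t_msort f (drop h xs) +
        t_merge f (msort f (take h xs)) (msort f (drop h xs))"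
      using False by (subst t_msort.simps) (simp add: h_def Let_def)
    ultimately show ?thesis
      unfolding len by (simp add: power2_eq_square algebra_simps)
  qed
qed

text \<open>Only one half is being sorted at a time, so the sizes shrink geometrically along the
  recursion. For length L \<ge> 2 the induction needs 2L + 1 \<le> 8 (L div 2), which is tightest at
  L = 3.\<close>

lemma w_msort_le: "w_msort xs \<le> 8 * length xs + 1"
proof (induction xs rule: w_msort.induct)
  case (1 xs)
  then show ?case
    by (subst w_msort.simps) (auto simp: Let_def)
qed

section \<open>The store invariant\<close>

text \<open>\<open>L\<close> is the set of admissible lengths of the current permutation:
  \<open>{k}\<close> while it is being built, \<open>{n}\<close> once it is complete,
  \<open>{..n}\<close> elsewhere. Lists may repeat entries, so inclusion in \<open>V\<close> alone
  would not bound the cells they occupy.\<close>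

definition store_ok :: "'a set \<Rightarrow> nat set \<Rightarrow> 'a store \<Rightarrow> bool" where
  "store_ok V L s \<longleftrightarrow>
     dom (degs s) \<subseteq> V \<and> dom (b_arr s) \<subseteq> V \<and> dom (c_arr s) \<subseteq> V \<and>
     set (perm s) \<subseteq> V \<and> length (perm s) \<in> L \<and> before s \<subseteq> V \<and>
     dom (T_arr s) \<subseteq> V \<and> dom (MG s) \<subseteq> V \<and> dom (phi s) \<subseteq> V \<and>
     set (ranked s) \<subseteq> V \<and> length (ranked s) \<le> card V \<and>
     dom (flag s) \<subseteq> V \<and> seeds s \<subseteq> V"

text \<open>Eleven arrays, lists and sets of at most \<open>card V\<close> cells each, and two
  scalars.\<close>

lemma cells_le:
  assumes "finite V" "L \<subseteq> {..card V}" "store_ok V L s"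
  shows "cells s \<le> 11 * card V + 2"
proof -
  have card: "card D \<le> card V" if "D \<subseteq> V" for D
    using that assms(1) by (rule card_mono[rotated])
  have "length (perm s) \<le> card V" "length (ranked s) \<le> card V"
    using assms(2,3) by (auto simp: store_ok_def)
  moreover have "card (dom (degs s)) \<le> card V" "card (dom (b_arr s)) \<le> card V"
    "card (dom (c_arr s)) \<le> card V" "card (before s) \<le> card V"
    "card (dom (T_arr s)) \<le> card V" "card (dom (MG s)) \<le> card V" "card (dom (phi s)) \<le> card V"
    "card (dom (flag s)) \<le> card V" "card (seeds s) \<le> card V"
    using assms(3) by (auto simp: store_ok_def intro!: card)
  ultimately show ?thesis by (simp add: cells_def)
qed

text \<open>Both written entries are themselves entries of \<open>xs\<close>.\<close>

lemma set_swap_subset: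
  assumes "set xs \<subseteq> V" "j < length xs" "k < length xs"
  shows "set (xs[j := xs ! k, k := xs ! j]) \<subseteq> V"
  using assms by (meson nth_mem set_update_subsetI subsetD)

section \<open>Resources of the phases\<close>

text \<open>One input together with constants extracted from the asymptotic assumptions.
  \<open>M\<close> adds up the store (11n + 2), the working space of merge sort (8n + 1) and that of
  a subroutine (\<open>w\<close>).\<close>

locale resource_bounds =
  fixes Q :: "('a, 'b) subroutines" and I :: "('a, 'b) bim" and A :: "'a params"
    and V :: "'a set" and n W K w M :: nat
  assumes inst: "bim_instance I" and params: "valid_params I A"
    and V_def: "V = verts (net I)" and n_def: "n = num_nodes I"
    and W_def: "W = num_edges I + n" and M_def: "M = 19 * n + 3 + w"
    and deg_time_le: "deg_time Q I \<le> K * n\<^sup>2"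
    and mc_time_le: "\<And>S u. S \<subseteq> V \<Longrightarrow> u \<in> V \<Longrightarrow> mc_time Q I S u \<le> K * W"
    and deg_work_le: "deg_work Q I \<le> w"
    and mc_work_le: "\<And>S u. S \<subseteq> V \<Longrightarrow> u \<in> V \<Longrightarrow> mc_work Q I S u \<le> w"
begin

abbreviation ok :: "'a store \<Rightarrow> bool" where "ok \<equiv> store_ok V {..n}"
abbreviation ok_perm :: "'a store \<Rightarrow> bool" where "ok_perm \<equiv> store_ok V {n}"

section \<open>Sizes determined by the instance\<close>

lemma finite_V: "finite V"
  using inst by (auto simp: bim_instance_def V_def digraph_def fin_digraph_def fin_digraph_axioms_def)

lemma card_V: "card V = n"
  by (simp add: V_def n_def num_nodes_def)

lemma n_pos: "1 \<le> n"
  using inst finite_V card_V by (auto simp: bim_instance_def V_def Suc_le_eq card_gt_0_iff)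

lemma n_le_W: "n \<le> W"
  by (simp add: W_def)

lemma set_nodes: "set (nodes A) = V"
  using params by (simp add: valid_params_def V_def)

lemma length_nodes: "length (nodes A) = n"
  using params by (metis card_V distinct_card set_nodes valid_params_def)

text \<open>Distinctness turns the length of the list into the size of a subset of \<open>V\<close>.
  Bounding every degree by \<open>n\<close> makes a scan of all neighbourhoods quadratic in
  \<open>n\<close>.\<close>

lemma adj_bounds:
  assumes "u \<in> V"
  shows "length (adj A u) \<le> n \<and> set (adj A u) \<subseteq> V"
proof -
  have "distinct (adj A u)" "set (adj A u) = nbrs I u"
    using assms params by (auto simp: valid_params_def V_def)
  moreover have "nbrs I u \<subseteq> V" by (auto simp: nbrs_def V_def)
  ultimately show ?thesis
    by (metis card_V card_mono distinct_card finite_V)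
qed

section \<open>Triples for the store invariant\<close>

lemma cells_ok:
  assumes "L \<subseteq> {..n}" "store_ok V L s"
  shows "cells s \<le> 11 * n + 2"
  using cells_le[OF finite_V _ assms(2)] assms(1) by (simp add: card_V)

text \<open>The slack in \<open>p\<close> lets one bound serve at every nesting depth, since each
  enclosing \<open>foreach\<close> adds a cell for its loop variable.\<close>

lemma cells_le_M:
  assumes "L \<subseteq> {..n}" "store_ok V L s" "M \<le> p"
  shows "cells s \<le> p"
  using cells_ok[OF assms(1,2)] assms(3) by (simp add: M_def)

lemma runs_step_ok:
  assumes "\<And>s. store_ok V L s \<Longrightarrow> store_ok V L' (f s)" "L \<subseteq> {..n}" "L' \<subseteq> {..n}" "M \<le> p"
  shows "runs (store_ok V L) (step f) (store_ok V L') 1 p"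
  using assms by (intro runs_step) (auto intro: cells_le_M)

lemma runs_foreach_ok:
  assumes "\<And>s. store_ok V L s \<Longrightarrow> length (xs s) \<le> N \<and> set (xs s) \<subseteq> X"
    and "\<And>x. x \<in> X \<Longrightarrow> runs (store_ok V L) (c x) (store_ok V L) t p"
    and "L \<subseteq> {..n}" "M \<le> p"
  shows "runs (store_ok V L) (foreach xs c) (store_ok V L) (Suc (N * Suc t)) (Suc p)"
  using assms by (intro runs_foreach[of _ xs N X]) (auto intro: cells_le_M)

lemma runs_nodes_ok:
  assumes "\<And>u. u \<in> V \<Longrightarrow> runs (store_ok V L) (c u) (store_ok V L) t p" "L \<subseteq> {..n}" "M \<le> p"
  shows "runs (store_ok V L) (foreach (\<lambda>_. nodes A) c) (store_ok V L) (Suc (n * Suc t)) (Suc p)"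
  using assms by (intro runs_foreach_ok) (auto simp: length_nodes set_nodes)

lemma runs_adj_ok:
  assumes "\<And>v. v \<in> V \<Longrightarrow> runs (store_ok V L) (c v) (store_ok V L) t p" "L \<subseteq> {..n}" "M \<le> p"
    and "u \<in> V"
  shows "runs (store_ok V L) (foreach (\<lambda>_. adj A u) c) (store_ok V L) (Suc (n * Suc t)) (Suc p)"
  using assms adj_bounds by (intro runs_foreach_ok) auto

section \<open>Algorithm A\<close>

lemma runs_compute_degrees: "runs ok (compute_degrees Q I) ok (K * n\<^sup>2) M"
  unfolding compute_degrees_def
proof (rule runs_call)
  fix s assume s: "ok s"
  let ?s = "degs_update (\<lambda>_ u. if u \<in> verts (net I) then Some (deg I u) else None) s"
  have s': "ok ?s" using s by (auto simp: store_ok_def V_def split: if_splits)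
  moreover have "cells s + deg_work Q I \<le> M"
    using cells_ok[OF _ s] deg_work_le by (simp add: M_def)
  moreover have "cells ?s \<le> M" by (rule cells_le_M[OF _ s']) auto
  ultimately show "ok ?s \<and> deg_time Q I \<le> K * n\<^sup>2 \<and> cells s + deg_work Q I \<le> M \<and> cells ?s \<le> M"
    using deg_time_le by auto
qed

lemma runs_compute_range: "runs ok (compute_range I A) ok (15 * n\<^sup>2) (Suc (Suc M))"
proof -
  have "runs ok (compute_range I A) ok
      (Suc (n * Suc (1 + (1 + Suc (n * Suc 1)))) + (1 + (Suc (n * Suc 1) + 1))) (Suc (Suc M))"
    unfolding compute_range_def
    by (intro runs_andthen[of _ _ ok] runs_nodes_ok runs_adj_ok runs_step_ok)
      (auto simp: store_ok_def)
  then show ?thesis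
  proof (rule runs_weaken)
    \<comment> \<open>As 1 \<le> n \<le> n^2, the exact count 2n^2 + 6n + 4 is at most
      12n^2.\<close>
    have "n \<le> n\<^sup>2" by (simp add: power2_eq_square)
    moreover have "Suc (n * Suc (1 + (1 + Suc (n * Suc 1)))) + (1 + (Suc (n * Suc 1) + 1))
        = 2 * n\<^sup>2 + 6 * n + 4"
      by (simp add: power2_eq_square algebra_simps)
    ultimately show "Suc (n * Suc (1 + (1 + Suc (n * Suc 1)))) + (1 + (Suc (n * Suc 1) + 1))
        \<le> 15 * n\<^sup>2"
      using n_pos by linarith
  qed simp
qed

text \<open>Appending raises the length from 0 to \<open>n\<close>, one per pass; the swaps then
  preserve the length and stay inside \<open>V\<close>. The count is 4n + 3 \<le> 7n.\<close>

lemma runs_generate_perm: "runs ok (generate_perm A i) ok_perm (7 * n) (Suc M)"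
proof -
  have "runs ok (step (\<lambda>s. s\<lparr>perm := []\<rparr>)) (store_ok V {0}) 1 (Suc M)"
    by (rule runs_step_ok) (auto simp: store_ok_def)
  moreover have "runs (store_ok V {0})
      (foreach (\<lambda>_. nodes A) (\<lambda>u. step (\<lambda>s. s\<lparr>perm := perm s @ [u]\<rparr>)))
      (store_ok V {length (nodes A)}) (Suc (length (nodes A) * Suc 1)) (Suc M)"
  proof (rule runs_foreach_indexed[where J = "\<lambda>k. store_ok V {k}"])
    fix k u assume "k < length (nodes A)" "u \<in> set (nodes A)"
    then show "runs (store_ok V {k}) (step (\<lambda>s. s\<lparr>perm := perm s @ [u]\<rparr>))
        (store_ok V {Suc k}) 1 M"
      by (intro runs_step_ok) (auto simp: store_ok_def length_nodes set_nodes)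
  next
    fix k s assume "k \<le> length (nodes A)" "store_ok V {k} s"
    then show "cells s \<le> M"
      by (intro cells_le_M[of "{k}"]) (auto simp: length_nodes)
  qed
  moreover have "runs ok_perm
      (foreach (\<lambda>_. rev [1..<length (nodes A)]) (\<lambda>k.
        step (\<lambda>s. let j = draw A i k mod Suc k in
          s\<lparr>perm := (perm s)[j := perm s ! k, k := perm s ! j]\<rparr>)))
      ok_perm (Suc (n * Suc 1)) (Suc M)"
  proof (rule runs_foreach_ok[where X = "{..<n}"])
    fix k assume k: "k \<in> {..<n}"
    \<comment> \<open>Reduction modulo \<open>Suc k\<close> gives a position at most
      \<open>k\<close>, so both swapped positions are valid.\<close>
    have "draw A i k mod Suc k < n"
      using k by (metis lessThan_iff less_Suc_eq_le mod_less_divisor order_le_less_trans zero_less_Suc)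
    with k show "runs ok_perm (step (\<lambda>s. let j = draw A i k mod Suc k in
          s\<lparr>perm := (perm s)[j := perm s ! k, k := perm s ! j]\<rparr>)) ok_perm 1 M"
      by (intro runs_step_ok) (use set_swap_subset in \<open>auto simp: store_ok_def Let_def\<close>)
  qed (auto simp: length_nodes)
  ultimately have "runs ok (generate_perm A i) ok_perm
      (1 + (Suc (n * Suc 1) + Suc (n * Suc 1))) (Suc M)"
    unfolding generate_perm_def length_nodes by (blast intro: runs_andthen)
  then show ?thesis
    by (rule runs_weaken) (use n_pos in auto)
qed

lemma runs_add_marginal:
  assumes "u \<in> V"
  shows "runs ok_perm (add_marginal Q I u) ok_perm (2 * n + 2 + K * W) (Suc M)"
proof -
  have "runs ok_perm (call (\<lambda>s. mc_time Q I (before s) u) (\<lambda>s. mc_work Q I (before s) u)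
       (\<lambda>s. s\<lparr>T_arr := (T_arr s)(u \<mapsto>
          the (T_arr s u) + influence I (before s \<union> {u}) - influence I (before s))\<rparr>))
     ok_perm (K * W) (Suc M)" (is "runs _ (call ?t ?w ?f) _ _ _")
  proof (rule runs_call)
    fix s assume s: "ok_perm s"
    \<comment> \<open>The cost assumptions on the subroutine cover only subsets of \<open>V\<close>;
      the invariant supplies this.\<close>
    have "before s \<subseteq> V" using s by (simp add: store_ok_def)
    then have "?t s \<le> K * W" "?w s \<le> w"
      using mc_time_le mc_work_le assms by auto
    moreover have s': "ok_perm (?f s)" using s assms by (auto simp: store_ok_def)
    moreover have "cells s + w \<le> M"
      using cells_ok[OF _ s] by (simp add: M_def)
    moreover have "cells (?f s) \<le> M" by (rule cells_le_M[OF _ s']) auto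
    ultimately show "ok_perm (?f s) \<and> ?t s \<le> K * W \<and> cells s + ?w s \<le> Suc M
        \<and> cells (?f s) \<le> Suc M" by linarith
  qed
  moreover have "runs ok_perm (foreach (\<lambda>s. takeWhile (\<lambda>w. w \<noteq> u) (perm s)) (\<lambda>w.
       step (\<lambda>s. s\<lparr>before := insert w (before s)\<rparr>))) ok_perm (Suc (n * Suc 1)) (Suc M)"
  proof (rule runs_foreach_ok[where X = V])
    fix s assume "ok_perm s"
    then show "length (takeWhile (\<lambda>w. w \<noteq> u) (perm s)) \<le> n
        \<and> set (takeWhile (\<lambda>w. w \<noteq> u) (perm s)) \<subseteq> V"
      using length_takeWhile_le[of "\<lambda>w. w \<noteq> u" "perm s"]
      by (auto simp: store_ok_def dest: set_takeWhileD)
  next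
    fix x assume "x \<in> V"
    then show "runs ok_perm (step (\<lambda>s. s\<lparr>before := insert x (before s)\<rparr>)) ok_perm 1 M"
      by (intro runs_step_ok) (auto simp: store_ok_def)
  qed auto
  moreover have "runs ok_perm (step (\<lambda>s. s\<lparr>before := {}\<rparr>)) ok_perm 1 (Suc M)"
    by (rule runs_step_ok) (auto simp: store_ok_def)
  ultimately have "runs ok_perm (add_marginal Q I u) ok_perm
      (1 + (Suc (n * Suc 1) + K * W)) (Suc M)"
    unfolding add_marginal_def by (blast intro: runs_andthen)
  then show ?thesis
    by (rule runs_weaken) auto
qed

text \<open>The cost of one permutation. The three extra cells are the variables of the nested loops
  over repetitions, nodes and predecessors.\<close>

lemma runs_round:
  "runs ok (generate_perm A i \<triangleright>
       foreach (\<lambda>_. nodes A) (\<lambda>u. step (\<lambda>s. s\<lparr>T_arr := (T_arr s)(u \<mapsto> 0)\<rparr>)) \<triangleright>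
       foreach (\<lambda>_. [1..<Suc (reps A)]) (\<lambda>j.
         foreach (\<lambda>_. nodes A) (\<lambda>u.
           add_marginal Q I u \<triangleright>
           step (\<lambda>s. s\<lparr>MG := (MG s)(u \<mapsto> the (T_arr s u) / real (reps A))\<rparr>))))
     ok ((K + 19) * (n * W * reps A)) (Suc (Suc (Suc M)))"
    (is "runs ok ?c ok _ _")
proof -
  have marginal: "runs ok_perm (add_marginal Q I u \<triangleright>
       step (\<lambda>s. s\<lparr>MG := (MG s)(u \<mapsto> the (T_arr s u) / real (reps A))\<rparr>))
     ok_perm (2 * n + 2 + K * W + 1) (Suc M)" if "u \<in> V" for u
    using that
    by (intro runs_andthen[of _ _ ok_perm] runs_add_marginal runs_step_ok) (auto simp: store_ok_def)
  have gen: "runs ok (generate_perm A i) ok_perm (7 * n) (Suc (Suc (Suc M)))"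
    by (rule runs_weaken[OF runs_generate_perm]) auto
  have init: "runs ok_perm (foreach (\<lambda>_. nodes A) (\<lambda>u.
      step (\<lambda>s. s\<lparr>T_arr := (T_arr s)(u \<mapsto> 0)\<rparr>))) ok_perm (Suc (n * Suc 1)) (Suc (Suc (Suc M)))"
    by (intro runs_nodes_ok runs_step_ok) (auto simp: store_ok_def)
  have loop: "runs ok_perm (foreach (\<lambda>_. [1..<Suc (reps A)]) (\<lambda>j.
         foreach (\<lambda>_. nodes A) (\<lambda>u.
           add_marginal Q I u \<triangleright>
           step (\<lambda>s. s\<lparr>MG := (MG s)(u \<mapsto> the (T_arr s u) / real (reps A))\<rparr>))))
     ok_perm (Suc (reps A * Suc (Suc (n * Suc (2 * n + 2 + K * W + 1))))) (Suc (Suc (Suc M)))"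
    by (intro runs_foreach_ok[where X = UNIV] runs_nodes_ok marginal) auto
  have "runs ok ?c ok_perm (7 * n + (Suc (n * Suc 1) +
      Suc (reps A * Suc (Suc (n * Suc (2 * n + 2 + K * W + 1)))))) (Suc (Suc (Suc M)))"
    by (intro runs_andthen[OF gen] runs_andthen[OF init] loop)
  \<comment> \<open>Relaxing \<open>ok_perm\<close> to \<open>ok\<close> makes the round preserve
    the invariant it started from, as the loop over permutations requires.\<close>
  then have "runs ok ?c ok (7 * n + (Suc (n * Suc 1) +
      Suc (reps A * Suc (Suc (n * Suc (2 * n + 2 + K * W + 1)))))) (Suc (Suc (Suc M)))"
    by (rule runs_consequence) (auto simp: store_ok_def)
  then show ?thesis
  proof (rule runs_weaken)
    have W: "1 \<le> W" using n_pos n_le_W by simp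
    have R: "1 \<le> reps A" using params by (simp add: valid_params_def)
    have n: "n \<le> n * W * reps A" using mult_le_mono[OF mult_le_mono[OF order_refl W] R, of n] by simp
    \<comment> \<open>The left side is the cost per node including the loop step; n \<le> W and 1
      \<le> W turn 2n + 4 into 6W. Two more units of overhead give K + 8 below.\<close>
    have "2 * n + 2 + K * W + 2 \<le> (K + 6) * W" using n_le_W W by (simp add: algebra_simps)
    then have "n * Suc (2 * n + 2 + K * W + 1) \<le> n * ((K + 6) * W)" by (intro mult_le_mono2) simp
    moreover have "1 * 1 \<le> n * W" using n_pos W by (intro mult_le_mono)
    ultimately have "Suc (Suc (n * Suc (2 * n + 2 + K * W + 1))) \<le> (K + 8) * (n * W)"
      by (simp add: algebra_simps)
    then have "reps A * Suc (Suc (n * Suc (2 * n + 2 + K * W + 1))) \<le> reps A * ((K + 8) * (n * W))"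
      by (rule mult_le_mono2)
    also have "\<dots> = (K + 8) * (n * W * reps A)" by (simp add: algebra_simps)
    finally have rounds: "reps A * Suc (Suc (n * Suc (2 * n + 2 + K * W + 1)))
        \<le> (K + 8) * (n * W * reps A)" .
    \<comment> \<open>The work outside the repetitions is 9n + 2 \<le> 11X, hence 8 + 11 = 19.
      Abstracting the products to \<open>X\<close> and \<open>Y\<close> keeps the arithmetic linear
      in them.\<close>
    have arith: "7 * n + (Suc (n * Suc 1) + Suc Y) \<le> (K + 19) * X"
      if "Y \<le> (K + 8) * X" "n \<le> X" for X Y
      using that n_pos by (simp add: algebra_simps)
    show "7 * n + (Suc (n * Suc 1) +
      Suc (reps A * Suc (Suc (n * Suc (2 * n + 2 + K * W + 1))))) \<le> (K + 19) * (n * W * reps A)"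
      by (rule arith[OF rounds n])
  qed simp
qed

text \<open>The permutation loop contributes (K + 20)X with X = \<tau> n W R; the degrees contribute
  at most KX, and all the rest at most 23X.\<close>

lemma runs_approx_shapley:
  "runs ok (approx_shapley Q I A) ok
     (2 * (K + 22) * (tau A * (n * W * reps A))) (Suc (Suc (Suc (Suc M))))"
proof -
  let ?p = "Suc (Suc (Suc (Suc M)))" and ?U = "n * W * reps A"
  have degrees: "runs ok (compute_degrees Q I) ok (K * n\<^sup>2) ?p"
    by (rule runs_weaken[OF runs_compute_degrees]) auto
  have rng: "runs ok (compute_range I A) ok (15 * n\<^sup>2) ?p"
    by (rule runs_weaken[OF runs_compute_range]) auto
  have init: "runs ok (foreach (\<lambda>_. nodes A) (\<lambda>u.
       step (\<lambda>s. s\<lparr>phi := (phi s)(u \<mapsto> 0)\<rparr>) \<triangleright>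
       step (\<lambda>s. s\<lparr>MG := (MG s)(u \<mapsto> 0)\<rparr>))) ok (Suc (n * Suc (1 + 1))) ?p"
    by (intro runs_nodes_ok runs_andthen[of _ _ ok] runs_step_ok) (auto simp: store_ok_def)
  have loop: "runs ok (foreach (\<lambda>_. [1..<Suc (tau A)]) (\<lambda>i.
       generate_perm A i \<triangleright>
       foreach (\<lambda>_. nodes A) (\<lambda>u. step (\<lambda>s. s\<lparr>T_arr := (T_arr s)(u \<mapsto> 0)\<rparr>)) \<triangleright>
       foreach (\<lambda>_. [1..<Suc (reps A)]) (\<lambda>j.
         foreach (\<lambda>_. nodes A) (\<lambda>u.
           add_marginal Q I u \<triangleright>
           step (\<lambda>s. s\<lparr>MG := (MG s)(u \<mapsto> the (T_arr s u) / real (reps A))\<rparr>)))))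
      ok (Suc (tau A * Suc ((K + 19) * ?U))) ?p"
    by (rule runs_foreach_ok[where X = UNIV], simp, rule runs_round) auto
  have final: "runs ok (foreach (\<lambda>_. nodes A) (\<lambda>u.
       step (\<lambda>s. s\<lparr>phi := (phi s)(u \<mapsto> the (MG s u) / real (tau A))\<rparr>))) ok (Suc (n * Suc 1)) ?p"
    by (intro runs_nodes_ok runs_step_ok) (auto simp: store_ok_def)
  have "runs ok (approx_shapley Q I A) ok
     (K * n\<^sup>2 + (15 * n\<^sup>2 + (Suc (n * Suc (1 + 1)) +
       (Suc (tau A * Suc ((K + 19) * ?U)) + Suc (n * Suc 1))))) ?p"
    unfolding approx_shapley_def
    by (intro runs_andthen[OF degrees] runs_andthen[OF rng] runs_andthen[OF init]
        runs_andthen[OF loop] final)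
  then show ?thesis
  proof (rule runs_weaken)
    have "1 \<le> tau A" "1 \<le> reps A" using params by (auto simp: valid_params_def)
    \<comment> \<open>One factor \<open>n\<close> is bounded by \<open>W\<close>, and \<tau> and R
      are at least 1, so every quadratic phase is absorbed.\<close>
    then have "1 * (n * n * 1) \<le> tau A * ?U"
      using n_le_W by (intro mult_le_mono) auto
    then have sq: "n\<^sup>2 \<le> tau A * ?U" by (simp add: power2_eq_square)
    have n: "n \<le> n\<^sup>2" using n_pos by (simp add: power2_eq_square)
    have "1 * 1 * 1 \<le> ?U" using n_pos n_le_W \<open>1 \<le> reps A\<close> by (intro mult_le_mono) auto
    then have "Suc ((K + 19) * ?U) \<le> (K + 20) * ?U" by (simp add: algebra_simps)
    then have "tau A * Suc ((K + 19) * ?U) \<le> tau A * ((K + 20) * ?U)" by (rule mult_le_mono2)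
    also have "\<dots> = (K + 20) * (tau A * ?U)" by (simp add: algebra_simps)
    finally have tau: "tau A * Suc ((K + 19) * ?U) \<le> (K + 20) * (tau A * ?U)" .
    have arith: "K * n\<^sup>2 + (15 * n\<^sup>2 + (Suc (n * Suc (1 + 1)) + (Suc Y + Suc (n * Suc 1))))
        \<le> 2 * (K + 22) * X" if "Y \<le> (K + 20) * X" "n\<^sup>2 \<le> X" for X Y
    proof -
      have "K * n\<^sup>2 \<le> K * X" using that(2) by (rule mult_le_mono2)
      moreover have "Y \<le> K * X + 20 * X" "2 * (K + 22) * X = K * X + K * X + 44 * X"
        using that(1) by (simp_all add: algebra_simps)
      moreover have "Suc (n * Suc (1 + 1)) + (Suc Y + Suc (n * Suc 1)) = 3 + 5 * n + Y"
        by simp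
      ultimately show ?thesis using that(2) n n_pos by linarith
    qed
    show "K * n\<^sup>2 + (15 * n\<^sup>2 + (Suc (n * Suc (1 + 1)) +
       (Suc (tau A * Suc ((K + 19) * ?U)) + Suc (n * Suc 1)))) \<le> 2 * (K + 22) * (tau A * ?U)"
      by (rule arith[OF tau sq])
  qed simp
qed

section \<open>Method 1\<close>

text \<open>Each visited node is charged for the dearer branch of both conditionals and for clearing
  up to \<open>n\<close> flags, giving 2n^2 to leading order; sorting adds 4n^2 + 1. The bound on
  \<open>length (ranked s)\<close> in the invariant limits the number of visits.\<close>

lemma runs_select_seeds: "runs ok (select_seeds I A) ok (19 * n\<^sup>2) (Suc (Suc M))"
proof -
  have "runs ok (sort_nodes A) ok (4 * n\<^sup>2 + 1) (Suc (Suc M))"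
    unfolding sort_nodes_def
  proof (rule runs_call)
    fix s assume s: "ok s"
    let ?f = "\<lambda>s::'a store. s\<lparr>ranked := msort (\<lambda>u. the (phi s u)) (nodes A)\<rparr>"
    have s': "ok (?f s)" using s by (auto simp: store_ok_def set_nodes length_nodes card_V)
    have "cells s + w_msort (nodes A) \<le> M"
      using cells_ok[OF _ s] w_msort_le[of "nodes A"] by (simp add: M_def length_nodes)
    moreover have "cells (?f s) \<le> M" by (rule cells_le_M[OF _ s']) auto
    moreover have "t_msort (\<lambda>u. the (phi s u)) (nodes A) \<le> 4 * n\<^sup>2 + 1"
      using t_msort_le[of "\<lambda>u. the (phi s u)" "nodes A"] by (simp add: length_nodes)
    ultimately show "ok (?f s) \<and> t_msort (\<lambda>u. the (phi s u)) (nodes A) \<le> 4 * n\<^sup>2 + 1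
        \<and> cells s + w_msort (nodes A) \<le> Suc (Suc M) \<and> cells (?f s) \<le> Suc (Suc M)"
      using s' by simp
  qed
  moreover have "runs ok (step (\<lambda>s. s\<lparr>seeds := {}\<rparr>)) ok 1 (Suc (Suc M))"
    by (rule runs_step_ok) (auto simp: store_ok_def)
  moreover have "runs ok (foreach (\<lambda>_. nodes A) (\<lambda>u. step (\<lambda>s. s\<lparr>flag := (flag s)(u \<mapsto> 1)\<rparr>)))
      ok (Suc (n * Suc 1)) (Suc (Suc M))"
    by (intro runs_nodes_ok runs_step_ok) (auto simp: store_ok_def)
  moreover have "runs ok (foreach ranked (\<lambda>u.
       cond (\<lambda>s. money s > 0)
         (cond (\<lambda>s. money s \<ge> cost I u \<and> the (flag s u) = 1)
            (step (\<lambda>s. s\<lparr>seeds := seeds s \<union> {u}\<rparr>) \<triangleright>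
             step (\<lambda>s. s\<lparr>money := money s - cost I u\<rparr>))
            skip \<triangleright>
          foreach (\<lambda>_. adj A u) (\<lambda>v. step (\<lambda>s. s\<lparr>flag := (flag s)(v \<mapsto> 0)\<rparr>)))
         skip)) ok (Suc (n * Suc (Suc (max (Suc (max (1 + 1) 0) + Suc (n * Suc 1)) 0)))) (Suc (Suc M))"
  proof (rule runs_foreach_ok[where X = V])
    fix u assume "u \<in> V"
    have skip: "runs ok skip ok 0 (Suc M)"
      by (rule runs_skip) (auto intro: cells_le_M)
    have add: "runs ok (step (\<lambda>s. s\<lparr>seeds := seeds s \<union> {u}\<rparr>) \<triangleright>
             step (\<lambda>s. s\<lparr>money := money s - cost I u\<rparr>)) ok (1 + 1) (Suc M)"
      using \<open>u \<in> V\<close> by (intro runs_andthen[of _ _ ok] runs_step_ok) (auto simp: store_ok_def)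
    have clear: "runs ok (foreach (\<lambda>_. adj A u) (\<lambda>v. step (\<lambda>s. s\<lparr>flag := (flag s)(v \<mapsto> 0)\<rparr>)))
        ok (Suc (n * Suc 1)) (Suc M)"
      using \<open>u \<in> V\<close> by (intro runs_adj_ok runs_step_ok) (auto simp: store_ok_def)
    show "runs ok (cond (\<lambda>s. money s > 0)
         (cond (\<lambda>s. money s \<ge> cost I u \<and> the (flag s u) = 1)
            (step (\<lambda>s. s\<lparr>seeds := seeds s \<union> {u}\<rparr>) \<triangleright>
             step (\<lambda>s. s\<lparr>money := money s - cost I u\<rparr>))
            skip \<triangleright>
          foreach (\<lambda>_. adj A u) (\<lambda>v. step (\<lambda>s. s\<lparr>flag := (flag s)(v \<mapsto> 0)\<rparr>)))
         skip) ok (Suc (max (Suc (max (1 + 1) 0) + Suc (n * Suc 1)) 0)) (Suc M)"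
      by (rule runs_cond[OF runs_andthen[OF runs_cond[OF add skip] clear] skip])
  qed (auto simp: store_ok_def card_V)
  ultimately have "runs ok (select_seeds I A) ok (4 * n\<^sup>2 + 1 + (1 + (Suc (n * Suc 1) +
      Suc (n * Suc (Suc (max (Suc (max (1 + 1) 0) + Suc (n * Suc 1)) 0)))))) (Suc (Suc M))"
    unfolding select_seeds_def by (blast intro: runs_andthen)
  then show ?thesis
  proof (rule runs_weaken)
    \<comment> \<open>The total 6n^2 + 8n + 4 is at most 18n^2 for n \<ge> 1.\<close>
    have "n \<le> n\<^sup>2" by (simp add: power2_eq_square)
    moreover have "4 * n\<^sup>2 + 1 + (1 + (Suc (n * Suc 1) +
        Suc (n * Suc (Suc (max (Suc (max (1 + 1) 0) + Suc (n * Suc 1)) 0))))) = 6 * n\<^sup>2 + 8 * n + 4"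
      by (simp add: power2_eq_square algebra_simps)
    ultimately show "4 * n\<^sup>2 + 1 + (1 + (Suc (n * Suc 1) +
      Suc (n * Suc (Suc (max (Suc (max (1 + 1) 0) + Suc (n * Suc 1)) 0))))) \<le> 19 * n\<^sup>2"
      using n_pos by linarith
  qed simp
qed

section \<open>Bounds for the complete run\<close>

text \<open>The times add: 2(K + 22) + 19 = 2K + 63, the quadratic term being absorbed as before.
  The peaks do not add: the larger one is M + 4 = 19n + 7 + w, and 7 \<le> 7n.\<close>

lemma methodology_bounds:
  "running_time Q I A \<le> (2 * K + 63) * (tau A * (n * W * reps A))"
  "extra_space Q I A \<le> 26 * n + w"
proof -
  have ok: "ok (initial_store I)"
    by (simp add: store_ok_def initial_store_def)
  have "runs ok (select_seeds I A) ok (19 * n\<^sup>2) (Suc (Suc (Suc (Suc M))))"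
    by (rule runs_weaken[OF runs_select_seeds]) auto
  from runs_andthen[OF runs_approx_shapley this] ok
  have time: "running_time Q I A \<le> 2 * (K + 22) * (tau A * (n * W * reps A)) + 19 * n\<^sup>2"
    and space: "extra_space Q I A \<le> Suc (Suc (Suc (Suc M)))"
    by (simp_all add: runs_def running_time_def extra_space_def methodology_def)
  have "1 \<le> tau A" "1 \<le> reps A" using params by (auto simp: valid_params_def)
  then have "1 * (n * n * 1) \<le> tau A * (n * W * reps A)"
    using n_le_W by (intro mult_le_mono) auto
  then have "n\<^sup>2 \<le> tau A * (n * W * reps A)" by (simp add: power2_eq_square)
  with time show "running_time Q I A \<le> (2 * K + 63) * (tau A * (n * W * reps A))"
    by (simp add: algebra_simps)
  show "extra_space Q I A \<le> 26 * n + w"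
    using space n_pos by (simp add: M_def)
qed

end

section \<open>Asymptotics\<close>

text \<open>For a principal filter, holding eventually means holding on all of \<open>X\<close>. The
  constant is rounded up to a natural number because the resource bounds are counted in
  \<open>nat\<close>.\<close>

lemma bigo_principal_natD:
  fixes f :: "'c \<Rightarrow> real"
  assumes "f \<in> O[principal X](g)"
  obtains K :: nat where "\<And>x. x \<in> X \<Longrightarrow> f x \<le> real K * \<bar>g x\<bar>"
proof -
  obtain c where c: "\<And>x. x \<in> X \<Longrightarrow> \<bar>f x\<bar> \<le> c * \<bar>g x\<bar>"
    using assms by (auto simp: bigo_def eventually_principal)
  have "f x \<le> real (nat \<lceil>c\<rceil>) * \<bar>g x\<bar>" if "x \<in> X" for x
  proof -
    have "f x \<le> c * \<bar>g x\<bar>" using c[OF that] by simp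
    also have "\<dots> \<le> real (nat \<lceil>c\<rceil>) * \<bar>g x\<bar>"
      by (intro mult_right_mono real_nat_ceiling_ge) simp
    finally show ?thesis .
  qed
  then show ?thesis by (rule that)
qed

lemma bigo_principalI:
  fixes f g :: "'c \<Rightarrow> real"
  assumes "\<And>x. x \<in> X \<Longrightarrow> \<bar>f x\<bar> \<le> c * \<bar>g x\<bar>"
  shows "f \<in> O[principal X](g)"
  by (rule bigoI[of _ c]) (use assms in \<open>simp add: eventually_principal\<close>)

theorem theorem1:
  fixes Q :: "('a, 'b) subroutines"
  assumes deg_time: "(\<lambda>I. real (deg_time Q I))
      \<in> O[principal instances](\<lambda>I. (real (num_nodes I))\<^sup>2)"
    and deg_work: "(\<lambda>I. real (deg_work Q I))
      \<in> O[principal instances](\<lambda>I. real (num_nodes I))"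
    and mc_time: "(\<lambda>(I, S, u). real (mc_time Q I S u))
      \<in> O[principal mc_inputs](\<lambda>(I, S, u). real (num_edges I + num_nodes I))"
    and mc_work: "(\<lambda>(I, S, u). real (mc_work Q I S u))
      \<in> O[principal mc_inputs](\<lambda>(I, S, u). real (num_nodes I))"
  shows "(\<lambda>(I, A). real (running_time Q I A))
      \<in> O[principal run_inputs](\<lambda>(I, A).
          real (tau A) * real (num_nodes I) * real (num_edges I + num_nodes I) * real (reps A)
          + real (num_nodes I) * log 2 (real (num_nodes I))
          + real (num_nodes I) * real (max_deg I))
    \<and> (\<lambda>(I, A). real (extra_space Q I A))
      \<in> O[principal run_inputs](\<lambda>(I, A). real (num_nodes I))"
proof -
  \<comment> \<open>All four constants are fixed before any input is considered; they depend on
    \<open>Q\<close> alone.\<close>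
  obtain K1 :: nat where K1: "\<And>I. I \<in> instances \<Longrightarrow>
      real (deg_time Q I) \<le> real K1 * \<bar>(real (num_nodes I))\<^sup>2\<bar>"
    by (rule bigo_principal_natD[OF deg_time]) blast
  obtain K2 :: nat where K2: "\<And>I. I \<in> instances \<Longrightarrow>
      real (deg_work Q I) \<le> real K2 * \<bar>real (num_nodes I)\<bar>"
    by (rule bigo_principal_natD[OF deg_work]) blast
  obtain K3 :: nat where K3: "\<And>I S u. (I, S, u) \<in> mc_inputs \<Longrightarrow>
      real (mc_time Q I S u) \<le> real K3 * \<bar>real (num_edges I + num_nodes I)\<bar>"
    by (rule bigo_principal_natD[OF mc_time]) fast
  obtain K4 :: nat where K4: "\<And>I S u. (I, S, u) \<in> mc_inputs \<Longrightarrow>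
      real (mc_work Q I S u) \<le> real K4 * \<bar>real (num_nodes I)\<bar>"
    by (rule bigo_principal_natD[OF mc_work]) fast
  \<comment> \<open>\<open>K1 + K3\<close> dominates both time constants and \<open>K2 + K4\<close>
    both space constants, which provides the single \<open>K\<close> and \<open>w\<close> of the
    locale.\<close>
  have bounds:
    "running_time Q I A \<le>
      (2 * (K1 + K3) + 63) * (tau A * (num_nodes I * (num_edges I + num_nodes I) * reps A))"
    "extra_space Q I A \<le> 26 * num_nodes I + (K2 + K4) * num_nodes I"
    "1 \<le> num_nodes I"
    if "(I, A) \<in> run_inputs" for I A
  proof -
    have I: "bim_instance I" and A: "valid_params I A" using that by (auto simp: run_inputs_def)
    have mc: "mc_time Q I S u \<le> (K1 + K3) * (num_edges I + num_nodes I)"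
      "mc_work Q I S u \<le> (K2 + K4) * num_nodes I"
      if "S \<subseteq> verts (net I)" "u \<in> verts (net I)" for S u
    proof -
      have "(I, S, u) \<in> mc_inputs" using I that by (simp add: mc_inputs_def)
      from K3[OF this] K4[OF this]
      have "mc_time Q I S u \<le> K3 * (num_edges I + num_nodes I)"
        "mc_work Q I S u \<le> K4 * num_nodes I"
        by (simp_all flip: of_nat_mult of_nat_add)
      then show "mc_time Q I S u \<le> (K1 + K3) * (num_edges I + num_nodes I)"
        "mc_work Q I S u \<le> (K2 + K4) * num_nodes I"
        by (simp_all add: algebra_simps)
    qed
    have "real (deg_time Q I) \<le> real (K1 * (num_nodes I)\<^sup>2)"
      "real (deg_work Q I) \<le> real (K2 * num_nodes I)"
      using K1[of I] K2[of I] I by (simp_all add: instances_def)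
    then have "deg_time Q I \<le> (K1 + K3) * (num_nodes I)\<^sup>2"
      "deg_work Q I \<le> (K2 + K4) * num_nodes I"
      unfolding of_nat_le_iff by (simp_all add: algebra_simps)
    with I A mc interpret resource_bounds Q I A "verts (net I)" "num_nodes I"
      "num_edges I + num_nodes I" "K1 + K3" "(K2 + K4) * num_nodes I"
      "19 * num_nodes I + 3 + (K2 + K4) * num_nodes I"
      by unfold_locales auto
    show "running_time Q I A \<le>
      (2 * (K1 + K3) + 63) * (tau A * (num_nodes I * (num_edges I + num_nodes I) * reps A))"
      "extra_space Q I A \<le> 26 * num_nodes I + (K2 + K4) * num_nodes I"
      "1 \<le> num_nodes I"
      using methodology_bounds n_pos by auto
  qed
  show ?thesis
  proof (intro conjI bigo_principalI)
    fix x :: "('a, 'b) bim \<times> 'a params" assume "x \<in> run_inputs"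
    moreover obtain I A where x: "x = (I, A)" by (cases x)
    ultimately have run: "(I, A) \<in> run_inputs" by simp
    let ?U = "real (tau A) * real (num_nodes I) * real (num_edges I + num_nodes I) * real (reps A)"
    let ?L = "real (num_nodes I) * log 2 (real (num_nodes I))"
    let ?D = "real (num_nodes I) * real (max_deg I)"
    have "real (running_time Q I A) \<le>
        real ((2 * (K1 + K3) + 63) * (tau A * (num_nodes I * (num_edges I + num_nodes I) * reps A)))"
      using bounds(1)[OF run] by (simp only: of_nat_le_iff)
    also have "\<dots> = real (2 * (K1 + K3) + 63) * ?U" by (simp only: of_nat_mult mult_ac)
    also have "\<dots> \<le> real (2 * (K1 + K3) + 63) * \<bar>?U + ?L + ?D\<bar>"
    proof (rule mult_left_mono)
      \<comment> \<open>The sorting and degree terms only enlarge the right-hand side, so the bound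
        by \<open>?U\<close> suffices; n \<ge> 1 makes the logarithm nonnegative.\<close>
      have "0 \<le> ?L" "0 \<le> ?D" using bounds(3)[OF run] by auto
      then show "?U \<le> \<bar>?U + ?L + ?D\<bar>" by linarith
    qed simp
    finally show "\<bar>case x of (I, A) \<Rightarrow> real (running_time Q I A)\<bar>
        \<le> real (2 * (K1 + K3) + 63) * \<bar>case x of (I, A) \<Rightarrow>
          real (tau A) * real (num_nodes I) * real (num_edges I + num_nodes I) * real (reps A)
          + real (num_nodes I) * log 2 (real (num_nodes I))
          + real (num_nodes I) * real (max_deg I)\<bar>"
      by (simp add: x)
    have "real (extra_space Q I A) \<le> real ((26 + K2 + K4) * num_nodes I)"
      using bounds(2)[OF run] unfolding of_nat_le_iff by (simp add: algebra_simps)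
    then show "\<bar>case x of (I, A) \<Rightarrow> real (extra_space Q I A)\<bar>
        \<le> real (26 + K2 + K4) * \<bar>case x of (I, A) \<Rightarrow> real (num_nodes I)\<bar>"
      by (simp add: x)
  qed
qed

end
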